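(* For every disjunction-free formula $\phi\in\mathcal L$ (i.e. one not containing $\vee$) and every compactly branching WMTS $S$, $[\![\phi]\!]S=\sup_{I\in[\![S]\!]}[\![\phi]\!]I$.
   Context: Fix a finite set $\Sigma$ of actions and a real discounting factor $\lambda$ with $0<\lambda<1$. Let $\mathbb I=\{[x,y] : x\in\mathbb Z\cup\{-\infty\},\ y\in\mathbb Z\cup\{\infty\},\ x\le y\}$ and $\mathbb K=\Sigma\times\mathbb I$; implementation labels are $(a,[x,x])$, $x\in\mathbb Z$. Order $\mathbb I$ by $[x,y]\sqsubseteq[x',y']$ iff $x'\le x$, $y\le y'$, and $\mathbb K$ by $(a,I)\sqsubseteq(a',I')$ iff $a=a'$, $I\sqsubseteq I'$. A WMTS $S=(S,s^0,\dashrightarrow,\longrightarrow)$ consists of a set of states $S$, initial state $s^0$, may- and must-relations $\dashrightarrow,\longrightarrow\subseteq S\times\mathbb K\times S$ such that every $(s,k,s')\in\longrightarrow$ has some $(s,\ell,s')\in\dashrightarrow$ with $k\sqsubseteq\ell$. An implementation is a WMTS with $\dashrightarrow=\longrightarrow$ and only implementation labels. A modal refinement between $S_1,S_2$ is $R\subseteq S_1\times S_2$ such that for $(s_1,s_2)\in R$: every $s_1\overset{k_1}{\dashrightarrow}t_1$ is matched by some $s_2\overset{k_2}{\dashrightarrow}t_2$ with $k_1\sqsubseteq k_2$, $(t_1,t_2)\in R$; every $s_2\overset{k_2}{\longrightarrow}t_2$ is matched by some $s_1\overset{k_1}{\longrightarrow}t_1$ with $k_1\sqsubseteq k_2$, $(t_1,t_2)\in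 R$. $S_1\le_m S_2$ iff such $R$ contains $(s_1^0,s_2^0)$; $[\![S]\!]=\{I \text{ implementation} : I\le_m S\}$. Label distance $d_{\mathbb K}((a_1,I_1),(a_2,I_2))=\infty$ if $a_1\ne a_2$, $d_{\mathbb K}((a,[x_1,y_1]),(a,[x_2,y_2]))=\max(x_2-x_1,y_1-y_2,0)$. Modal refinement distance: least fixed point of $d_m(s_1,s_2)=\max\{\sup_{s_1\overset{k_1}{\dashrightarrow}t_1}\inf_{s_2\overset{k_2}{\dashrightarrow}t_2}(d_{\mathbb K}(k_1,k_2)+\lambda d_m(t_1,t_2)),\ \sup_{s_2\overset{k_2}{\longrightarrow}t_2}\inf_{s_1\overset{k_1}{\longrightarrow}t_1}(d_{\mathbb K}(k_1,k_2)+\lambda d_m(t_1,t_2))\}$ ($\sup\emptyset=0$, $\inf\emptyset=\infty$). A WMTS is compactly branching if for each state $s$ the sets $\{(s',k): s\overset{k}{\dashrightarrow}s'\}$, $\{(s',k): s\overset{k}{\longrightarrow}s'\}$ are compact under $((s',k),(s'',k''))\mapsto\bar d_m(s',s'')+\bar d_{\mathbb K}(k,k'')$, where $\bar d(x,y)=\max(d(x,y),d(y,x))$ and $d_m$ is taken from the WMTS to itself. The logic $\mathcal L$ is generated by $\phi::=\mathrm{tt}\mid\mathrm{ff}\mid\langle\ell\rangle\phi\mid[\ell]\phi\mid\phi_1\wedge\phi_2\mid\phi_1\vee\phi_2$ with $\ell\in\mathbb K$. For a WMTS $S$ the semantics $[\![\phi]\!]:S\to[0,\infty]$ is: $[\![\mathrm{tt}]\!]s=0$,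 $[\![\mathrm{ff}]\!]s=\infty$, $[\![\phi_1\wedge\phi_2]\!]s=\max([\![\phi_1]\!]s,[\![\phi_2]\!]s)$, $[\![\phi_1\vee\phi_2]\!]s=\min([\![\phi_1]\!]s,[\![\phi_2]\!]s)$, $[\![\langle\ell\rangle\phi]\!]s=\inf\{d_{\mathbb K}(k,\ell)+\lambda[\![\phi]\!]t : s\overset{k}{\longrightarrow}t,\ d_{\mathbb K}(k,\ell)\ne\infty\}$, $[\![[\ell]\phi]\!]s=\sup\{d_{\mathbb K}(k,\ell)+\lambda[\![\phi]\!]t : s\overset{k}{\dashrightarrow}t,\ d_{\mathbb K}(k,\ell)\ne\infty\}$ (with $\inf\emptyset=\infty$, $\sup\emptyset=0$); $[\![\phi]\!]S=[\![\phi]\!]s^0$, and implementations are evaluated as WMTS.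
   Formalization: In the semantics of [ℓ]φ the condition d_K(k,ℓ) ≠ ∞ is replaced by "k and ℓ have the same action"; with the printed condition the claim fails, e.g. for a single may-transition (a,[-∞,∞]) and the formula [(a,[0,0])]tt. *)

theory Defs
  imports "HOL-Analysis.Analysis"
begin

section \<open>Weighted labels\<close>

typedef interval =
  "{(x :: ereal, y :: ereal).
      x \<in> range (\<lambda>n::int. ereal (of_int n)) \<union> {-\<infinity>} \<and>
      y \<in> range (\<lambda>n::int. ereal (of_int n)) \<union> {\<infinity>} \<and> x \<le> y}"
  by (rule exI[of _ "(-\<infinity>, \<infinity>)"]) simp

definition lower :: "interval \<Rightarrow> ereal" where
  "lower I = fst (Rep_interval I)"

definition upper :: "interval \<Rightarrow> ereal" where
  "upper I = snd (Rep_interval I)"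

definition interval_le :: "interval \<Rightarrow> interval \<Rightarrow> bool" where
  "interval_le I J \<longleftrightarrow> lower J \<le> lower I \<and> upper I \<le> upper J"

text \<open>Actions are the elements of a type \<open>'a\<close>, which is constrained to class \<open>finite\<close> where needed.\<close>

type_synonym 'a label = "'a \<times> interval"

definition label_le :: "'a label \<Rightarrow> 'a label \<Rightarrow> bool" where
  "label_le k l \<longleftrightarrow> fst k = fst l \<and> interval_le (snd k) (snd l)"

definition impl_label :: "'a label \<Rightarrow> bool" where
  "impl_label k \<longleftrightarrow>
     (\<exists>n::int. lower (snd k) = ereal (of_int n) \<and> upper (snd k) = ereal (of_int n))"

text \<open>On \<^typ>\<open>ereal\<close> one has \<open>\<infinity> - \<infinity> = \<infinity>\<close>; the distance between two equal infinite bounds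
  has to be \<open>0\<close> instead.\<close>

definition bound_diff :: "ereal \<Rightarrow> ereal \<Rightarrow> ereal" where
  "bound_diff u v = (if u = v then 0 else u - v)"

definition label_dist :: "'a label \<Rightarrow> 'a label \<Rightarrow> ennreal" where
  "label_dist k l =
     (if fst k \<noteq> fst l then \<infinity>
      else e2ennreal (max (max (bound_diff (lower (snd l)) (lower (snd k)))
                               (bound_diff (upper (snd k)) (upper (snd l)))) 0))"

lemma lower_not_PInf: "lower I \<noteq> \<infinity>" and upper_not_MInf: "upper I \<noteq> -\<infinity>"
  using Rep_interval[of I] by (auto simp: lower_def upper_def split: prod.splits)

lemma label_dist_eq_infinity_iff:
  "label_dist k l = \<infinity> \<longleftrightarrow>
     fst k \<noteq> fst l
     \<or> (lower (snd k) = -\<infinity> \<and> lower (snd l) \<noteq> -\<infinity>)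
     \<or> (upper (snd k) = \<infinity> \<and> upper (snd l) \<noteq> \<infinity>)"
proof (cases "fst k = fst l")
  case True
  have e: "e2ennreal (max z 0) = \<infinity> \<longleftrightarrow> z = \<infinity>" for z :: ereal
  proof
    assume "e2ennreal (max z 0) = \<infinity>"
    moreover have "enn2ereal (e2ennreal (max z 0)) = max z 0"
      by (rule enn2ereal_e2ennreal) simp
    ultimately have "max z 0 = \<infinity>"
      by simp
    then show "z = \<infinity>"
      by (auto simp: max_def split: if_splits)
  qed simp
  have m: "max u v = \<infinity> \<longleftrightarrow> u = \<infinity> \<or> v = \<infinity>" for u v :: ereal
    by (auto simp: max_def)
  have l: "bound_diff (lower J) (lower I) = \<infinity> \<longleftrightarrow> lower I = -\<infinity> \<and> lower J \<noteq> -\<infinity>" for I J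
    using lower_not_PInf[of I] lower_not_PInf[of J]
    by (cases "lower I"; cases "lower J") (simp_all add: bound_diff_def)
  have u: "bound_diff (upper I) (upper J) = \<infinity> \<longleftrightarrow> upper I = \<infinity> \<and> upper J \<noteq> \<infinity>" for I J
    using upper_not_MInf[of I] upper_not_MInf[of J]
    by (cases "upper I"; cases "upper J") (simp_all add: bound_diff_def)
  show ?thesis
    using True by (simp only: label_dist_def e m l u if_False not_True_eq_False simp_thms)
qed (simp add: label_dist_def)

section \<open>Weighted modal transition systems\<close>

record ('a, 's) wmts =
  states :: "'s set"
  init :: 's
  may :: "('s \<times> 'a label \<times> 's) set"
  must :: "('s \<times> 'a label \<times> 's) set"

definition is_wmts :: "('a, 's) wmts \<Rightarrow> bool" where
  "is_wmts S \<longleftrightarrow>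
     init S \<in> states S \<and>
     may S \<subseteq> states S \<times> UNIV \<times> states S \<and>
     must S \<subseteq> states S \<times> UNIV \<times> states S \<and>
     (\<forall>s k s'. (s, k, s') \<in> must S \<longrightarrow> (\<exists>l. (s, l, s') \<in> may S \<and> label_le k l))"

definition is_implementation :: "('a, 's) wmts \<Rightarrow> bool" where
  "is_implementation I \<longleftrightarrow>
     is_wmts I \<and> may I = must I \<and> (\<forall>s k s'. (s, k, s') \<in> may I \<longrightarrow> impl_label k)"

definition modal_refinement ::
  "('a, 's) wmts \<Rightarrow> ('a, 't) wmts \<Rightarrow> ('s \<times> 't) set \<Rightarrow> bool" where
  "modal_refinement S T R \<longleftrightarrow>
     R \<subseteq> states S \<times> states T \<and>
     (\<forall>(s, t) \<in> R.
        (\<forall>k s'. (s, k, s') \<in> may S \<longrightarrow>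
           (\<exists>l t'. (t, l, t') \<in> may T \<and> label_le k l \<and> (s', t') \<in> R)) \<and>
        (\<forall>l t'. (t, l, t') \<in> must T \<longrightarrow>
           (\<exists>k s'. (s, k, s') \<in> must S \<and> label_le k l \<and> (s', t') \<in> R)))"

definition refines :: "('a, 's) wmts \<Rightarrow> ('a, 't) wmts \<Rightarrow> bool" where
  "refines S T \<longleftrightarrow> (\<exists>R. modal_refinement S T R \<and> (init S, init T) \<in> R)"

definition implementations :: "('a, 's) wmts \<Rightarrow> ('a, 'i) wmts set" where
  "implementations S = {I. is_implementation I \<and> refines I S}"

text \<open>The class of all implementations of a system with states in \<open>'s\<close> is spread over all types
  of states, but a supremum in HOL has to be taken at one type. Implementations are therefore
  taken with states in \<open>'i + 's \<times> nat\<close>, where \<open>'i\<close> is an arbitrary type. As \<open>'i\<close> is a free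
  variable of the theorem, every implementation over any type whatsoever is, up to an injective
  renaming of its states, among them; the summand \<open>'s \<times> nat\<close> only keeps \<open>'i\<close> from being too
  small to provide implementations (a one-element type, say).\<close>

type_synonym ('i, 's) impl_state = "'i + 's \<times> nat"

section \<open>Modal refinement distance and compact branching\<close>

definition refinement_dist_step ::
  "real \<Rightarrow> ('a, 's) wmts \<Rightarrow> ('a, 't) wmts \<Rightarrow> ('s \<Rightarrow> 't \<Rightarrow> ennreal) \<Rightarrow> 's \<Rightarrow> 't \<Rightarrow> ennreal" where
  "refinement_dist_step lam S T d s t =
     max (SUP (k, s') \<in> {(k, s'). (s, k, s') \<in> may S}.
            INF (l, t') \<in> {(l, t'). (t, l, t') \<in> may T}.
              label_dist k l + ennreal lam * d s' t')
         (SUP (l, t') \<in> {(l, t'). (t, l, t') \<in> must T}.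
            INF (k, s') \<in> {(k, s'). (s, k, s') \<in> must S}.
              label_dist k l + ennreal lam * d s' t')"

definition refinement_dist ::
  "real \<Rightarrow> ('a, 's) wmts \<Rightarrow> ('a, 't) wmts \<Rightarrow> 's \<Rightarrow> 't \<Rightarrow> ennreal" where
  "refinement_dist lam S T = lfp (refinement_dist_step lam S T)"

lemma mono_refinement_dist_step:
  fixes S :: "('a, 's) wmts" and T :: "('a, 't) wmts"
  shows "mono (refinement_dist_step lam S T)"
proof (rule monoI, rule le_funI, rule le_funI)
  fix d e :: "'s \<Rightarrow> 't \<Rightarrow> ennreal" and s t
  assume "d \<le> e"
  then have *: "d s t \<le> e s t" for s t
    by (auto simp: le_fun_def)
  show "refinement_dist_step lam S T d s t \<le> refinement_dist_step lam S T e s t"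
    unfolding refinement_dist_step_def case_prod_unfold
    by (intro max.mono SUP_mono' INF_mono' add_mono mult_left_mono * order_refl) simp_all
qed

definition symmetrize :: "('b \<Rightarrow> 'b \<Rightarrow> ennreal) \<Rightarrow> 'b \<Rightarrow> 'b \<Rightarrow> ennreal" where
  "symmetrize d x y = max (d x y) (d y x)"

definition branch_dist ::
  "real \<Rightarrow> ('a, 's) wmts \<Rightarrow> 's \<times> 'a label \<Rightarrow> 's \<times> 'a label \<Rightarrow> ennreal" where
  "branch_dist lam S p q =
     symmetrize (refinement_dist lam S S) (fst p) (fst q) +
     symmetrize label_dist (snd p) (snd q)"

text \<open>The topology of a pseudometric with values in \<open>[0, \<infinity>]\<close>. The library's \<open>Metric_space\<close> does
  not apply, since distances may be infinite and distinct points may have distance \<open>0\<close>.\<close>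

definition pseudometric_topology :: "('b \<Rightarrow> 'b \<Rightarrow> ennreal) \<Rightarrow> 'b topology" where
  "pseudometric_topology d =
     topology (\<lambda>U. \<forall>x\<in>U. \<exists>\<epsilon>>0. \<forall>y. d x y < \<epsilon> \<longrightarrow> y \<in> U)"

lemma openin_pseudometric_topology:
  "openin (pseudometric_topology d) U \<longleftrightarrow> (\<forall>x\<in>U. \<exists>\<epsilon>>0. \<forall>y. d x y < \<epsilon> \<longrightarrow> y \<in> U)"
proof -
  have "istopology (\<lambda>U. \<forall>x\<in>U. \<exists>\<epsilon>>0. \<forall>y. d x y < \<epsilon> \<longrightarrow> y \<in> U)"
    unfolding istopology_def
  proof (intro conjI allI impI ballI)
    fix U V x
    assume U: "\<forall>x\<in>U. \<exists>\<epsilon>>0. \<forall>y. d x y < \<epsilon> \<longrightarrow> y \<in> U"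
      and V: "\<forall>x\<in>V. \<exists>\<epsilon>>0. \<forall>y. d x y < \<epsilon> \<longrightarrow> y \<in> V" and x: "x \<in> U \<inter> V"
    obtain e1 where e1: "e1 > 0" "\<And>y. d x y < e1 \<Longrightarrow> y \<in> U"
      using U x by blast
    obtain e2 where e2: "e2 > 0" "\<And>y. d x y < e2 \<Longrightarrow> y \<in> V"
      using V x by blast
    show "\<exists>\<epsilon>>0. \<forall>y. d x y < \<epsilon> \<longrightarrow> y \<in> U \<inter> V"
      by (rule exI[of _ "min e1 e2"]) (use e1 e2 in auto)
  next
    fix \<U> x
    assume *: "\<forall>U\<in>\<U>. \<forall>x\<in>U. \<exists>\<epsilon>>0. \<forall>y. d x y < \<epsilon> \<longrightarrow> y \<in> U" and x: "x \<in> \<Union>\<U>"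
    then obtain U where "U \<in> \<U>" "x \<in> U" by blast
    with * obtain e where "e > 0" "\<And>y. d x y < e \<Longrightarrow> y \<in> U" by blast
    with \<open>U \<in> \<U>\<close> show "\<exists>\<epsilon>>0. \<forall>y. d x y < \<epsilon> \<longrightarrow> y \<in> \<Union>\<U>" by blast
  qed
  then show ?thesis
    unfolding pseudometric_topology_def by (simp add: topology_inverse')
qed

definition compactly_branching :: "real \<Rightarrow> ('a, 's) wmts \<Rightarrow> bool" where
  "compactly_branching lam S \<longleftrightarrow>
     (\<forall>s \<in> states S.
        compactin (pseudometric_topology (branch_dist lam S)) {(s', k). (s, k, s') \<in> may S} \<and>
        compactin (pseudometric_topology (branch_dist lam S)) {(s', k). (s, k, s') \<in> must S})"

section \<open>The logic\<close>

datatype 'a formula =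
    TT
  | FF
  | Dia "'a label" "'a formula"
  | Box "'a label" "'a formula"
  | And "'a formula" "'a formula"
  | Or "'a formula" "'a formula"

primrec disjunction_free :: "'a formula \<Rightarrow> bool" where
  "disjunction_free TT \<longleftrightarrow> True"
| "disjunction_free FF \<longleftrightarrow> True"
| "disjunction_free (Dia l \<phi>) \<longleftrightarrow> disjunction_free \<phi>"
| "disjunction_free (Box l \<phi>) \<longleftrightarrow> disjunction_free \<phi>"
| "disjunction_free (And \<phi> \<psi>) \<longleftrightarrow> disjunction_free \<phi> \<and> disjunction_free \<psi>"
| "disjunction_free (Or \<phi> \<psi>) \<longleftrightarrow> False"

text \<open>The side condition \<open>label_dist k l \<noteq> \<infinity>\<close> of the modalities is there to discard transitions on
  other actions. In the clause for boxes it is read in exactly this sense, \<open>fst k = fst l\<close>. By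
  \<open>label_dist_eq_infinity_iff\<close> the two conditions differ only when \<open>k\<close> has an infinite bound where
  \<open>l\<close> has a finite one. Discarding those transitions too would make the semantics of boxes
  non-monotone under modal refinement: with one may-transition \<open>(a, [-\<infinity>, \<infinity>])\<close> and no must-transition,
  the formula \<open>[(a, [0, 0])] tt\<close> would have value \<open>0\<close>, although it has value \<open>5\<close> in the
  implementation with one transition \<open>(a, [5, 5])\<close>. For diamonds the two conditions are
  equivalent, as an infinite summand does not affect the infimum.\<close>

primrec formula_sem :: "real \<Rightarrow> ('a, 's) wmts \<Rightarrow> 'a formula \<Rightarrow> 's \<Rightarrow> ennreal" where
  "formula_sem lam S TT s = 0"
| "formula_sem lam S FF s = \<infinity>"
| "formula_sem lam S (Dia l \<phi>) s =
     Inf {label_dist k l + ennreal lam * formula_sem lam S \<phi> t | k t.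
            (s, k, t) \<in> must S \<and> label_dist k l \<noteq> \<infinity>}"
| "formula_sem lam S (Box l \<phi>) s =
     Sup {label_dist k l + ennreal lam * formula_sem lam S \<phi> t | k t.
            (s, k, t) \<in> may S \<and> fst k = fst l}"
| "formula_sem lam S (And \<phi> \<psi>) s = max (formula_sem lam S \<phi> s) (formula_sem lam S \<psi> s)"
| "formula_sem lam S (Or \<phi> \<psi>) s = min (formula_sem lam S \<phi> s) (formula_sem lam S \<psi> s)"

definition formula_value :: "real \<Rightarrow> 'a formula \<Rightarrow> ('a, 's) wmts \<Rightarrow> ennreal" where
  "formula_value lam \<phi> S = formula_sem lam S \<phi> (init S)"

end

theory Submission
  imports Defs
begin

text \<open>Refinement can only decrease the value of a formula, which gives one inequality. For the
  other one, a single implementation is built whose states are tagged copies of the states of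
  \<open>S\<close>: a state tagged \<open>(\<phi>, q)\<close> copies a state \<open>s\<close> with \<open>q < \<lbrakk>\<phi>\<rbrakk>s\<close> (or \<open>q = 0\<close>) and is designed
  to give \<open>\<phi>\<close> at least the value \<open>q\<close>. It realizes every must-transition in all those ways that
  keep a diamond above \<open>q\<close>, it realizes every may-transition in all ways if \<open>\<phi>\<close> is a box, and at a
  conjunction it follows a conjunct whose value exceeds \<open>q\<close>. A disjunction would require both
  disjuncts to be handled at once. There are only countably many tags, so \<open>'s \<times> nat\<close> has enough
  room.\<close>

section \<open>Label distances\<close>

text \<open>Countability of labels lets tags be encoded by natural numbers. The two flags in
  \<open>?f\<close> tell infinite bounds from the bound 0, since \<open>real_of_ereal\<close> maps
  both infinities to 0.\<close>

instance interval :: countable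
proof
  let ?f = "\<lambda>I. (lower I = -\<infinity>, upper I = \<infinity>, \<lfloor>real_of_ereal (lower I)\<rfloor>, \<lfloor>real_of_ereal (upper I)\<rfloor>)"
  have "I = J" if "?f I = ?f J" for I J
  proof -
    have "Rep_interval I = Rep_interval J"
      using Rep_interval[of I] Rep_interval[of J] that
      by (auto simp: lower_def upper_def split: prod.splits)
    then show ?thesis
      by (simp add: Rep_interval_inject)
  qed
  then have "inj ?f"
    by (auto intro!: injI)
  then have "inj (to_nat \<circ> ?f)"
    by (intro inj_compose) auto
  then show "\<exists>f :: interval \<Rightarrow> nat. inj f"
    by blast
qed

instance formula :: (countable) countable
  by countable_datatype

lemma bound_diff_mono:
  assumes "u \<le> u'" "v' \<le> v"
  shows "bound_diff u v \<le> max (bound_diff u' v') 0"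
  using assms by (cases u; cases v; cases u'; cases v') (auto simp: bound_diff_def max_def)

lemma label_dist_mono:
  assumes "label_le k k'"
  shows "label_dist k l \<le> label_dist k' l"
proof -
  have "bound_diff (lower (snd l)) (lower (snd k)) \<le> max (bound_diff (lower (snd l)) (lower (snd k'))) 0"
    "bound_diff (upper (snd k)) (upper (snd l)) \<le> max (bound_diff (upper (snd k')) (upper (snd l))) 0"
    using assms by (auto intro!: bound_diff_mono simp: label_le_def interval_le_def)
  then show ?thesis
    using assms by (auto simp: label_dist_def label_le_def intro!: e2ennreal_mono)
      (auto simp: max_def split: if_splits)
qed

lemma label_le_refl: "label_le k k"
  by (simp add: label_le_def interval_le_def)

lemma label_le_trans: "label_le k l \<Longrightarrow> label_le l m \<Longrightarrow> label_le k m"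
  by (auto simp: label_le_def interval_le_def)

definition point :: "int \<Rightarrow> interval" where
  "point n = Abs_interval (ereal (of_int n), ereal (of_int n))"

lemma lower_point [simp]: "lower (point n) = ereal (of_int n)"
  and upper_point [simp]: "upper (point n) = ereal (of_int n)"
  by (simp_all add: point_def lower_def upper_def Abs_interval_inverse)

lemma impl_label_point [simp]: "impl_label (a, point n)"
  by (auto simp: impl_label_def)

lemma interval_cases:
  obtains (fin) m n where "lower I = ereal (of_int m)" "upper I = ereal (of_int n)" "m \<le> n"
  | (up) m where "lower I = ereal (of_int m)" "upper I = \<infinity>"
  | (down) n where "lower I = -\<infinity>" "upper I = ereal (of_int n)"
  | (all) "lower I = -\<infinity>" "upper I = \<infinity>"
  using Rep_interval[of I] by (auto simp: lower_def upper_def split: prod.splits)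

text \<open>Supplies points at the left end of an interval; if that end is infinite,
  \<open>x\<close> prescribes how far out the point must lie.\<close>

lemma ex_small_point: "\<exists>n. interval_le (point n) I \<and> (lower I = ereal (of_int n) \<or> lower I = -\<infinity> \<and> of_int n < x)"
  for x :: real
proof (cases I rule: interval_cases)
  case (down n)
  have "of_int (min n (\<lfloor>x\<rfloor> - 1)) < x"
    by (simp add: min_def) linarith
  with down show ?thesis
    by (intro exI[of _ "min n (\<lfloor>x\<rfloor> - 1)"]) (auto simp: interval_le_def)
next
  case all
  then show ?thesis
    by (intro exI[of _ "\<lfloor>x\<rfloor> - 1"]) (auto simp: interval_le_def; linarith)
qed (auto simp: interval_le_def)

lemma ex_large_point: "\<exists>n. interval_le (point n) I \<and> (upper I = ereal (of_int n) \<or> upper I = \<infinity> \<and> x < of_int n)"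
  for x :: real
proof (cases I rule: interval_cases)
  case (up n)
  have "x < of_int (max n (\<lfloor>x\<rfloor> + 1))"
    by (simp add: max_def) linarith
  with up show ?thesis
    by (intro exI[of _ "max n (\<lfloor>x\<rfloor> + 1)"]) (auto simp: interval_le_def)
next
  case all
  then show ?thesis
    by (intro exI[of _ "\<lfloor>x\<rfloor> + 1"]) (auto simp: interval_le_def)
qed (auto simp: interval_le_def)

lemma ex_impl_label:
  obtains k' where "impl_label k'" "label_le k' k"
  using ex_small_point[of "snd k" 0] impl_label_point[of "fst k"]
  by (metis fst_conv label_le_def snd_conv)

text \<open>The distance is a maximum of a part governed by the lower bound of \<open>k\<close> and
  one governed by the upper bound. A point at, or far enough towards, the end responsible for
  exceeding \<open>c\<close> keeps that part above \<open>c\<close>. An infinite distance is in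
  general only approached by points, hence the strict bound \<open>c\<close>.\<close>

lemma less_label_dist_impl_label:
  assumes "fst k = fst l" and c: "c < label_dist k l"
  shows "\<exists>k'. impl_label k' \<and> label_le k' k \<and> c < label_dist k' l"
proof -
  have "c < \<infinity>"
    using c top.not_eq_extremum by fastforce
  then obtain r where r: "c = ennreal r" "0 \<le> r"
    by (cases c) auto
  have less: "c < e2ennreal z \<longleftrightarrow> ereal r < z" for z
    using r by (cases z) (auto simp: ennreal_less_iff e2ennreal_ereal e2ennreal_neg)
  have dist: "c < label_dist k' l \<longleftrightarrow>
      ereal r < bound_diff (lower (snd l)) (lower (snd k')) \<or>
      ereal r < bound_diff (upper (snd k')) (upper (snd l))" if "fst k' = fst l" for k'
    using that r(2) by (simp add: label_dist_def less less_max_iff_disj)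
  obtain n where "interval_le (point n) (snd k)" "c < label_dist (fst k, point n) l"
  proof (cases "ereal r < bound_diff (lower (snd l)) (lower (snd k))")
    case True
    \<comment> \<open>If \<open>k\<close> is unbounded below, \<open>True\<close> and
      \<open>0 \<le> r\<close> force \<open>l\<close> to be bounded below, since equal infinite
      bounds have difference 0. The threshold then says that \<open>lower (snd l) - n\<close>
      exceeds \<open>r\<close>.\<close>
    obtain n where n: "interval_le (point n) (snd k)" "lower (snd k) = ereal (of_int n) \<or>
        lower (snd k) = -\<infinity> \<and> of_int n < real_of_ereal (lower (snd l)) - r"
      using ex_small_point by blast
    have "ereal r < bound_diff (lower (snd l)) (ereal (of_int n))"
      using n(2) True r(2) lower_not_PInf[of "snd l"]
      by (cases "lower (snd l)") (auto simp: bound_diff_def split: if_splits)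
    with n(1) show ?thesis
      using that dist assms(1) by simp
  next
    case False
    then have *: "ereal r < bound_diff (upper (snd k)) (upper (snd l))"
      using c dist assms(1) by blast
    obtain n where n: "interval_le (point n) (snd k)" "upper (snd k) = ereal (of_int n) \<or>
        upper (snd k) = \<infinity> \<and> real_of_ereal (upper (snd l)) + r < of_int n"
      using ex_large_point by blast
    have "ereal r < bound_diff (ereal (of_int n)) (upper (snd l))"
      using n(2) * r(2) upper_not_MInf[of "snd l"]
      by (cases "upper (snd l)") (auto simp: bound_diff_def split: if_splits)
    with n(1) show ?thesis
      using that dist assms(1) by simp
  qed
  then show ?thesis
    using impl_label_point by (metis fst_conv label_le_def snd_conv)
qed

declare split_paired_All [simp del] split_paired_Ex [simp del]

section \<open>Rational lower approximations\<close>

text \<open>Rationals keep the tags countable. Admitting \<open>q = 0\<close> provides a bound also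
  for the value 0, which nothing is strictly below.\<close>

definition below :: "rat \<Rightarrow> ennreal \<Rightarrow> bool" where
  "below q v \<longleftrightarrow> q = 0 \<or> ennreal (of_rat q) < v"

lemma SUP_below: "(SUP q \<in> {q. below q v}. ennreal (of_rat q)) = v"
proof (rule antisym)
  show "(SUP q \<in> {q. below q v}. ennreal (of_rat q)) \<le> v"
    by (rule SUP_least) (auto simp: below_def)
  show "v \<le> (SUP q \<in> {q. below q v}. ennreal (of_rat q))"
  proof (rule dense_le)
    fix x assume "x < v"
    then obtain q :: rat where "x < ennreal (of_rat q)" "ennreal (of_rat q) < v"
      using ennreal_rat_dense by blast
    then show "x \<le> (SUP q \<in> {q. below q v}. ennreal (of_rat q))"
      by (auto simp: below_def intro!: SUP_upper2[of q])
  qed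
qed

text \<open>Multiplication by \<open>lam\<close> and addition commute with suprema over nonempty
  sets, so the value of a transition is at most the supremum of the values obtained from
  implementation labels \<open>k'\<close> and rational bounds \<open>r\<close>. A nonzero
  \<open>q\<close> lies strictly below it, so one pair exceeds \<open>q\<close>.\<close>

lemma below_transition:
  assumes "fst k = fst l" and "below q (label_dist k l + ennreal lam * v)"
  shows "\<exists>k' r. impl_label k' \<and> label_le k' k \<and> below r v \<and>
    ennreal (of_rat q) \<le> label_dist k' l + ennreal lam * ennreal (of_rat r)"
proof (cases "q = 0")
  case True
  obtain k' where "impl_label k'" "label_le k' k"
    using ex_impl_label .
  with True show ?thesis
    by (intro exI[of _ k'] exI[of _ 0]) (simp add: below_def)
next
  case False
  let ?K = "{k'. impl_label k' \<and> label_le k' k}" and ?Q = "{r. below r v}"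
  let ?a = "\<lambda>k'. label_dist k' l" and ?b = "\<lambda>r. ennreal lam * ennreal (of_rat r)"
  have ne: "?K \<noteq> {}" "?Q \<noteq> {}"
    using ex_impl_label[of k] by (blast, auto simp: below_def)
  have v: "ennreal lam * v = (SUP r \<in> ?Q. ?b r)"
    unfolding SUP_mult_left_ennreal[symmetric] SUP_below ..
  have "label_dist k l \<le> (SUP k' \<in> ?K. ?a k')"
  proof (rule dense_le)
    fix c assume "c < label_dist k l"
    then obtain k' where "k' \<in> ?K" "c < ?a k'"
      using less_label_dist_impl_label[OF assms(1)] by blast
    then show "c \<le> (SUP k' \<in> ?K. ?a k')"
      by (meson SUP_upper2 less_imp_le)
  qed
  then have "label_dist k l + ennreal lam * v \<le> (SUP k' \<in> ?K. ?a k') + ennreal lam * v"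
    by (rule add_right_mono)
  also have "(SUP k' \<in> ?K. ?a k') + ennreal lam * v = (SUP k' \<in> ?K. SUP r \<in> ?Q. ?a k' + ?b r)"
    unfolding v by (subst ennreal_SUP_add_left[OF ne(1), symmetric])
      (simp only: ennreal_SUP_add_right[OF ne(2)])
  finally have "ennreal (of_rat q) < (SUP k' \<in> ?K. SUP r \<in> ?Q. ?a k' + ?b r)"
    using assms(2) False by (simp add: below_def)
  then obtain k' r where "k' \<in> ?K" "r \<in> ?Q" "ennreal (of_rat q) < ?a k' + ?b r"
    unfolding less_SUP_iff by blast
  then show ?thesis
    using less_imp_le by blast
qed

section \<open>Refinement decreases the value of a formula\<close>

text \<open>Must-transitions of \<open>t\<close> are matched in \<open>s\<close>, so the infimum of
  a diamond can only drop; may-transitions of \<open>s\<close> are matched in \<open>t\<close>, so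
  the supremum of a box at \<open>s\<close> is dominated. In both cases the refined label has the
  smaller distance to \<open>l\<close>, and refinement keeps the action.\<close>

lemma formula_sem_refinement:
  assumes R: "modal_refinement S T R" and "(s, t) \<in> R"
  shows "formula_sem lam S \<phi> s \<le> formula_sem lam T \<phi> t"
  using assms(2)
proof (induction \<phi> arbitrary: s t)
  case (Dia l \<phi>)
  show ?case
    unfolding formula_sem.simps
  proof (rule Inf_mono, clarify)
    fix k t'
    assume kt: "(t, k, t') \<in> must T" "label_dist k l \<noteq> \<infinity>"
    then obtain k' s' where *: "(s, k', s') \<in> must S" "label_le k' k" "(s', t') \<in> R"
      using R Dia.prems unfolding modal_refinement_def by blast
    have d: "label_dist k' l \<le> label_dist k l"
      using * label_dist_mono by blast
    with kt(2) have "label_dist k' l \<noteq> \<infinity>"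
      by (metis infinity_ennreal_def top.extremum_unique)
    then show "\<exists>a\<in>{label_dist k l + ennreal lam * formula_sem lam S \<phi> t |k t.
        (s, k, t) \<in> must S \<and> label_dist k l \<noteq> \<infinity>}.
        a \<le> label_dist k l + ennreal lam * formula_sem lam T \<phi> t'"
      using * d Dia.IH[OF *(3)]
      by (intro bexI[of _ "label_dist k' l + ennreal lam * formula_sem lam S \<phi> s'"])
        (auto intro!: add_mono mult_left_mono)
  qed
next
  case (Box l \<phi>)
  show ?case
    unfolding formula_sem.simps
  proof (rule Sup_mono, clarify)
    fix k s'
    assume ks: "(s, k, s') \<in> may S" "fst k = fst l"
    then obtain k' t' where *: "(t, k', t') \<in> may T" "label_le k k'" "(s', t') \<in> R"
      using R Box.prems unfolding modal_refinement_def by blast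
    then show "\<exists>b\<in>{label_dist k l + ennreal lam * formula_sem lam T \<phi> t' |k t'.
        (t, k, t') \<in> may T \<and> fst k = fst l}.
        label_dist k l + ennreal lam * formula_sem lam S \<phi> s' \<le> b"
      using ks Box.IH[OF *(3)] label_dist_mono[OF *(2), of l]
      by (intro bexI[of _ "label_dist k' l + ennreal lam * formula_sem lam T \<phi> t'"])
        (auto intro!: add_mono mult_left_mono simp: label_le_def)
  qed
next
  case (And \<phi> \<psi>)
  then show ?case
    unfolding formula_sem.simps by (intro max.mono)
next
  case (Or \<phi> \<psi>)
  then show ?case
    unfolding formula_sem.simps by (intro min.mono)
qed simp_all

lemma formula_value_refines: "refines S T \<Longrightarrow> formula_value lam \<phi> S \<le> formula_value lam \<phi> T"
  by (auto simp: refines_def formula_value_def intro: formula_sem_refinement)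

section \<open>The approximating implementation\<close>

type_synonym ('a, 's) node = "'s \<times> 'a formula \<times> rat"

context
  fixes lam :: real and S :: "('a, 's) wmts"
begin

definition valid_node :: "('a, 's) node \<Rightarrow> bool" where
  "valid_node = (\<lambda>(s, \<phi>, q). s \<in> states S \<and> below q (formula_sem lam S \<phi> s))"

primrec realizes :: "'a formula \<Rightarrow> rat \<Rightarrow> 's \<Rightarrow> 'a label \<Rightarrow> ('a, 's) node \<Rightarrow> 'a label \<Rightarrow> bool" where
  "realizes TT q s k' y k \<longleftrightarrow> (s, k, fst y) \<in> must S"
| "realizes FF q s k' y k \<longleftrightarrow> (s, k, fst y) \<in> must S"
| "realizes (Dia l \<phi>) q s k' y k \<longleftrightarrow> (s, k, fst y) \<in> must S \<and>
     (fst k = fst l \<longrightarrow> (\<exists>t r. y = (t, \<phi>, r) \<and>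
        ennreal (of_rat q) \<le> label_dist k' l + ennreal lam * ennreal (of_rat r)))"
| "realizes (Box l \<phi>) q s k' y k \<longleftrightarrow> (s, k, fst y) \<in> may S"
| "realizes (And \<phi> \<psi>) q s k' y k \<longleftrightarrow>
     (if below q (formula_sem lam S \<phi> s) then realizes \<phi> q s k' y k else realizes \<psi> q s k' y k)"
| "realizes (Or \<phi> \<psi>) q s k' y k \<longleftrightarrow> (s, k, fst y) \<in> must S"

definition node_step :: "'a formula \<Rightarrow> rat \<Rightarrow> 's \<Rightarrow> 'a label \<Rightarrow> ('a, 's) node \<Rightarrow> bool" where
  "node_step \<phi> q s k' y \<longleftrightarrow>
     valid_node y \<and> impl_label k' \<and> (\<exists>k. label_le k' k \<and> realizes \<phi> q s k' y k)"

definition node_steps :: "('n \<Rightarrow> ('a, 's) node) \<Rightarrow> ('n \<times> 'a label \<times> 'n) set" where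
  "node_steps p =
     {(x, k, y). valid_node (p x) \<and> (case p x of (s, \<phi>, q) \<Rightarrow> node_step \<phi> q s k (p y))}"

text \<open>The map \<open>p\<close> decodes the states, which may have any type with a surjection onto the nodes.\<close>

definition approx_impl :: "('n \<Rightarrow> ('a, 's) node) \<Rightarrow> 'n \<Rightarrow> ('a, 'n) wmts" where
  "approx_impl p x =
     \<lparr>states = {x. valid_node (p x)}, init = x, may = node_steps p, must = node_steps p\<rparr>"

lemma approx_impl_simps [simp]:
  "states (approx_impl p x) = {x. valid_node (p x)}" "init (approx_impl p x) = x"
  "may (approx_impl p x) = node_steps p" "must (approx_impl p x) = node_steps p"
  by (simp_all add: approx_impl_def)

lemma below_And_cases:
  assumes "below q (formula_sem lam S (And \<phi> \<psi>) s)"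
  obtains "below q (formula_sem lam S \<phi> s)"
  | "\<not> below q (formula_sem lam S \<phi> s)" "below q (formula_sem lam S \<psi> s)"
  using assms by (auto simp: below_def less_max_iff_disj)

text \<open>A diamond is an infimum, so a bound below it is below each candidate; a must-transition
  excluded by the side condition has infinite value.\<close>

lemma below_Dia:
  assumes "below q (formula_sem lam S (Dia l \<phi>) s)" "(s, k, t) \<in> must S"
  shows "below q (label_dist k l + ennreal lam * formula_sem lam S \<phi> t)"
proof (cases "label_dist k l = \<infinity>")
  case False
  then have "formula_sem lam S (Dia l \<phi>) s \<le> label_dist k l + ennreal lam * formula_sem lam S \<phi> t"
    using assms(2) by (auto intro!: Inf_lower)
  with assms(1) show ?thesis
    by (auto simp: below_def)
qed (simp add: below_def)

context
  assumes wmts: "is_wmts S"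
begin

lemma must_imp_may: "(s, k, t) \<in> must S \<Longrightarrow> \<exists>l. (s, l, t) \<in> may S \<and> label_le k l"
  using wmts unfolding is_wmts_def by blast

lemma target_in_states: "(s, k, t) \<in> must S \<Longrightarrow> t \<in> states S" "(s, k, t) \<in> may S \<Longrightarrow> t \<in> states S"
  using wmts unfolding is_wmts_def by blast+

lemma realizes_may:
  "realizes \<phi> q s k' y k \<Longrightarrow> \<exists>l. (s, l, fst y) \<in> may S \<and> label_le k l"
proof (induction \<phi>)
  case (Box l \<phi>)
  then show ?case
    using label_le_refl realizes.simps(4) by blast
next
  case (And \<phi> \<psi>)
  then show ?case
    by (simp split: if_splits)
qed (simp_all add: must_imp_may)

lemma node_step_must:
  assumes "(s, k, t) \<in> must S" and "below q (formula_sem lam S \<phi> s)"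
  shows "\<exists>k' \<psi> r. label_le k' k \<and> node_step \<phi> q s k' (t, \<psi>, r)"
proof -
  have t: "t \<in> states S"
    using assms(1) target_in_states by blast
  \<comment> \<open>This tag is valid at every state and serves whenever the target has no bound to
    meet.\<close>
  have TT: "valid_node (t, TT, 0)"
    using t by (simp add: valid_node_def below_def)
  obtain k0 where k0: "impl_label k0" "label_le k0 k"
    using ex_impl_label .
  show ?thesis
    using assms(2)
  proof (induction \<phi>)
    case (Dia l \<phi>)
    show ?case
    proof (cases "fst k = fst l")
      case True
      from below_transition[OF True below_Dia[OF Dia.prems assms(1)]]
      obtain k' r where "impl_label k'" "label_le k' k" "below r (formula_sem lam S \<phi> t)"
        "ennreal (of_rat q) \<le> label_dist k' l + ennreal lam * ennreal (of_rat r)"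
        by blast
      then show ?thesis
        using assms(1) t
        by (intro exI[of _ k'] exI[of _ \<phi>] exI[of _ r]) (auto simp: node_step_def valid_node_def)
    next
      case False
      with TT k0 assms(1) show ?thesis
        by (intro exI[of _ k0] exI[of _ TT] exI[of _ 0]) (auto simp: node_step_def)
    qed
  next
    case (Box l \<phi>)
    obtain k1 where "(s, k1, t) \<in> may S" "label_le k k1"
      using must_imp_may assms(1) by blast
    then show ?case
      using TT k0 by (intro exI[of _ k0] exI[of _ TT] exI[of _ 0])
        (auto simp: node_step_def intro: label_le_trans)
  next
    case (And \<phi> \<psi>)
    show ?case
      using And.prems by (rule below_And_cases) (use And.IH in \<open>auto simp: node_step_def\<close>)
  qed (use TT k0 assms(1) in \<open>auto simp: node_step_def\<close>)
qed

lemma is_implementation_approx_impl: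
  assumes "valid_node (p x)"
  shows "is_implementation (approx_impl p x)"
proof -
  have "valid_node (p y) \<and> valid_node (p z) \<and> impl_label k" if "(y, k, z) \<in> node_steps p" for y k z
    using that by (auto simp: node_steps_def node_step_def)
  then show ?thesis
    using assms label_le_refl unfolding is_implementation_def is_wmts_def approx_impl_simps
    by (intro conjI) (fast | auto)+
qed

lemma refines_approx_impl:
  assumes "surj p" "valid_node (p x)" "fst (p x) = init S"
  shows "refines (approx_impl p x) S"
proof -
  \<comment> \<open>Forgetting the tag relates each copy to its original; surjectivity of
    \<open>p\<close> gives every required target node a code.\<close>
  let ?R = "{(x, s). valid_node (p x) \<and> fst (p x) = s}"
  have "modal_refinement (approx_impl p x) S ?R"
    unfolding modal_refinement_def
  proof (intro conjI ballI, goal_cases)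
    case 1
    then show ?case
      by (auto simp: valid_node_def case_prod_unfold)
  next
    case (2 xs)
    then obtain x s \<phi> q where x: "xs = (x, s)" "p x = (s, \<phi>, q)" "valid_node (s, \<phi>, q)"
      by (cases xs; cases "p (fst xs)") auto
    have "\<exists>l t'. (s, l, t') \<in> may S \<and> label_le k l \<and> (y, t') \<in> ?R" if "(x, k, y) \<in> node_steps p" for k y
    proof -
      have "node_step \<phi> q s k (p y)"
        using that x(2) by (simp add: node_steps_def)
      then obtain k1 where "label_le k k1" "realizes \<phi> q s k (p y) k1" "valid_node (p y)"
        unfolding node_step_def by blast
      then show ?thesis
        using realizes_may label_le_trans by blast
    qed
    moreover have "\<exists>k y. (x, k, y) \<in> node_steps p \<and> label_le k l \<and> (y, t) \<in> ?R" if l: "(s, l, t) \<in> must S" for l t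
    proof -
      obtain k \<psi> r where *: "label_le k l" "node_step \<phi> q s k (t, \<psi>, r)"
        using node_step_must[OF l, of q \<phi>] x(3) unfolding valid_node_def by blast
      obtain y where "p y = (t, \<psi>, r)"
        using \<open>surj p\<close> by (metis surjD)
      with * x show ?thesis
        by (intro exI[of _ k] exI[of _ y]) (auto simp: node_steps_def node_step_def)
    qed
    ultimately show ?case
      using x by simp
  qed
  with assms show ?thesis
    unfolding refines_def by auto
qed

text \<open>The formula \<open>\<phi>\<close> need not be the one in the tag of \<open>x\<close>: at a conjunction the induction passes
  to a conjunct without changing the state.\<close>

lemma formula_sem_approx_impl:
  assumes "surj p" and "disjunction_free \<phi>"
    and "\<And>k y. (x, k, y) \<in> node_steps p \<longleftrightarrow> node_step \<phi> q s k (p y)"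
    and "below q (formula_sem lam S \<phi> s)"
  shows "ennreal (of_rat q) \<le> formula_sem lam (approx_impl p x0) \<phi> x"
  using assms(2-4)
proof (induction \<phi> arbitrary: x q s)
  case (Dia l \<phi>)
  show ?case
    unfolding formula_sem.simps
  proof (rule Inf_greatest, clarify)
    fix k y
    assume "(x, k, y) \<in> must (approx_impl p x0)" and "label_dist k l \<noteq> \<infinity>"
    \<comment> \<open>A finite distance means equal actions, so the constraint in
      \<open>realizes\<close> applies and fixes the tag of the target.\<close>
    then have "node_step (Dia l \<phi>) q s k (p y)" "fst k = fst l"
      using Dia.prems(2) label_dist_eq_infinity_iff[of k l] by (simp, blast)
    then obtain t r where y: "p y = (t, \<phi>, r)" "valid_node (p y)"
      and q: "ennreal (of_rat q) \<le> label_dist k l + ennreal lam * ennreal (of_rat r)"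
      by (auto simp: node_step_def label_le_def)
    have "ennreal (of_rat r) \<le> formula_sem lam (approx_impl p x0) \<phi> y"
      using y Dia.prems(1) by (intro Dia.IH[of y r t]) (auto simp: node_steps_def valid_node_def)
    then show "ennreal (of_rat q) \<le> label_dist k l + ennreal lam * formula_sem lam (approx_impl p x0) \<phi> y"
      by (intro order_trans[OF q] add_left_mono mult_left_mono) auto
  qed
next
  case (Box l \<phi>)
  show ?case
  proof (cases "q = 0")
    case False
    \<comment> \<open>The supremum exceeds \<open>q\<close>, so a single may-transition does. The
      node realizes it in all ways, including the one picked by
      \<open>below_transition\<close>.\<close>
    with Box.prems(3) obtain k t where kt: "(s, k, t) \<in> may S" "fst k = fst l"
      "ennreal (of_rat q) < label_dist k l + ennreal lam * formula_sem lam S \<phi> t"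
      by (auto simp: below_def less_Sup_iff)
    then obtain k' r where kr: "impl_label k'" "label_le k' k" "below r (formula_sem lam S \<phi> t)"
      and q: "ennreal (of_rat q) \<le> label_dist k' l + ennreal lam * ennreal (of_rat r)"
      using below_transition[of k l q lam "formula_sem lam S \<phi> t"] unfolding below_def by blast
    obtain y where y: "p y = (t, \<phi>, r)"
      using \<open>surj p\<close> by (metis surjD)
    have valid: "valid_node (p y)"
      using y kr kt target_in_states by (auto simp: valid_node_def)
    have "ennreal (of_rat r) \<le> formula_sem lam (approx_impl p x0) \<phi> y"
      using y valid Box.prems(1) by (intro Box.IH[of y r t]) (auto simp: node_steps_def valid_node_def)
    then have "ennreal (of_rat q) \<le> label_dist k' l + ennreal lam * formula_sem lam (approx_impl p x0) \<phi> y"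
      by (intro order_trans[OF q] add_left_mono mult_left_mono) auto
    moreover have "(x, k', y) \<in> may (approx_impl p x0)" "fst k' = fst l"
      using Box.prems(2)[of k' y] valid y kr kt by (auto simp: node_step_def label_le_def)
    ultimately show ?thesis
      unfolding formula_sem.simps by (blast intro: Sup_upper2)
  qed simp
next
  case (And \<phi> \<psi>)
  show ?case
    using And.prems(3)
  proof (rule below_And_cases)
    assume "below q (formula_sem lam S \<phi> s)"
    \<comment> \<open>Since \<open>realizes\<close> makes the same case distinction, the steps of
      \<open>x\<close> are exactly those of a node tagged with this conjunct.\<close>
    then have "ennreal (of_rat q) \<le> formula_sem lam (approx_impl p x0) \<phi> x"
      using And.prems(1,2) by (intro And.IH(1)[of x q s]) (simp_all add: node_step_def)
    then show ?thesis
      by (simp add: le_max_iff_disj)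
  next
    assume "\<not> below q (formula_sem lam S \<phi> s)" "below q (formula_sem lam S \<psi> s)"
    then have "ennreal (of_rat q) \<le> formula_sem lam (approx_impl p x0) \<psi> x"
      using And.prems(1,2) by (intro And.IH(2)[of x q s]) (simp_all add: node_step_def)
    then show ?thesis
      by (simp add: le_max_iff_disj)
  qed
qed (auto simp: below_def)

lemma ex_approximating_implementation:
  fixes p :: "'n \<Rightarrow> ('a, 's) node"
  assumes "surj p" and "disjunction_free \<phi>" and "below q (formula_value lam \<phi> S)"
  shows "\<exists>I \<in> (implementations S :: ('a, 'n) wmts set). ennreal (of_rat q) \<le> formula_value lam \<phi> I"
proof -
  obtain x where x: "p x = (init S, \<phi>, q)"
    using \<open>surj p\<close> by (metis surjD)
  have valid: "valid_node (p x)"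
    using assms(3) wmts x by (auto simp: valid_node_def formula_value_def is_wmts_def)
  have "approx_impl p x \<in> implementations S"
    using is_implementation_approx_impl[of p x] refines_approx_impl[of p x] assms(1) x valid
    by (auto simp: implementations_def)
  moreover have "ennreal (of_rat q) \<le> formula_value lam \<phi> (approx_impl p x)"
    unfolding formula_value_def using assms x valid
    by (intro formula_sem_approx_impl[of p \<phi> _ q "init S"])
      (auto simp: node_steps_def formula_value_def)
  ultimately show ?thesis
    by blast
qed

end

end

theorem theorem9:
  fixes lam :: real
    and \<phi> :: "'a::finite formula"
    and S :: "('a, 's) wmts"
  assumes "0 < lam" and "lam < 1"
    and "is_wmts S"
    and "compactly_branching lam S"
    and "disjunction_free \<phi>"
  shows "formula_value lam \<phi> S =
    (SUP I \<in> (implementations S :: ('a, ('i, 's) impl_state) wmts set). formula_value lam \<phi> I)"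
proof (rule antisym)
  let ?SUP = "SUP I \<in> (implementations S :: ('a, ('i, 's) impl_state) wmts set). formula_value lam \<phi> I"
  show "?SUP \<le> formula_value lam \<phi> S"
    by (rule SUP_least) (auto simp: implementations_def intro: formula_value_refines)
  \<comment> \<open>Numbers decode to pairs of a formula and a rational, so the right summand alone
    covers all nodes; the left summand gets a fixed default node.\<close>
  define p :: "('i, 's) impl_state \<Rightarrow> ('a, 's) node" where
    "p = case_sum (\<lambda>_. (init S, TT, 0)) (\<lambda>(s, n). (s, from_nat n))"
  have "p (Inr (fst y, to_nat (snd y))) = y" for y
    by (simp add: p_def)
  then have "surj p"
    by (rule surjI)
  \<comment> \<open>The left side is the value at \<open>S\<close>, so it suffices to reach each
    rational bound \<open>q\<close> by some implementation.\<close>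
  have "(SUP q \<in> {q. below q (formula_value lam \<phi> S)}. ennreal (of_rat q)) \<le> ?SUP"
    using ex_approximating_implementation[OF assms(3) \<open>surj p\<close> assms(5)]
    by (intro SUP_least) (auto intro: SUP_upper2)
  then show "formula_value lam \<phi> S \<le> ?SUP"
    by (simp add: SUP_below)
qed

end
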